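(* Let $n\ge1$ and let $(X,\lVert\cdot\rVert_X)$ be a quasi-Banach function space over $(\mathbb R^n,\lambda^n)$. Then $X$ is separable if and only if it has absolutely continuous quasinorm.
   Context: $\lambda^n$ is the Lebesgue measure on $\mathbb R^n$. $M=M(\mathbb R^n,\lambda^n)$ is the set of all measurable functions $\mathbb R^n\to\mathbb C\cup\{\infty\}$, functions equal a.e. being identified; $M_+$ is the subset of functions with values in $[0,\infty]$. A quasi-Banach function norm is a map $\lVert\cdot\rVert:M\to[0,\infty]$ with $\lVert\,|f|\,\rVert=\lVert f\rVert$ for all $f\in M$ whose restriction to $M_+$ satisfies: (Q1) (a) $\lVert af\rVert=|a|\lVert f\rVert$ for all $a\in\mathbb C$, $f\in M_+$ (with the usual convention $0\cdot\infty=0$); (b) $\lVert f\rVert=0$ iff $f=0$ a.e.; (c) there is a constant $C\ge1$ (the modulus of concavity) such that $\lVert f+g\rVert\le C(\lVert f\rVert+\lVert g\rVert)$ for all $f,g\in M_+$; (P2) if $f,g\in M_+$ and $f\le g$ a.e., then $\lVert f\rVert\le\lVert g\rVert$; (P3) if $f_k,f\in M_+$ and $f_k\uparrow f$ a.e., then $\lVert f_k\rVert\uparrow\lVert f\rVert$; (P4) $\lVert\chi_E\rVert<\infty$ for every measurable $E\subseteq\mathbb R^n$ with $\lambda^n(E)<\infty$. The corresponding quasi-Banach function space is $X=\{f\in M:\lVert f\rVert_X<\infty\}$ with the quasinorm $\lVert\cdot\rVert_X$, which induces a metrisable topology in which $f_k\to f$ iff $\lVert f_k-f\rVert_X\to0$.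 A function $f\in X$ has absolutely continuous quasinorm if $\lVert f\chi_{E_k}\rVert_X\to0$ whenever $(E_k)$ is a sequence of measurable subsets of $\mathbb R^n$ with $\chi_{E_k}\to0$ a.e. The space $X$ has absolutely continuous quasinorm if every $f\in X$ does. *)

theory Defs
  imports "HOL-Analysis.Analysis"
begin

text \<open>\<open>None\<close> is the point at infinity. It carries the Borel sets of the one-point
  compactification of the plane.\<close>

type_synonym ecomplex = "complex option"

definition ecborel :: "ecomplex measure" where
  "ecborel = sigma UNIV {U. openin (Alexandroff_compactification euclidean) U}"

lemma sets_ecborel_image_Some: "Some ` B \<in> sets ecborel" if "B \<in> sets borel"
proof -
  have *: "Some ` U \<in> sets ecborel" if "open U" for U
    using that unfolding ecborel_def
    by (auto simp: openin_Alexandroff_compactification intro!: sigma_sets.Basic)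
  from that have "B \<in> sigma_sets UNIV {S. open S}"
    by (simp add: borel_def)
  then show ?thesis
  proof (induction rule: sigma_sets.induct)
    case (Basic U) then show ?case using * by simp
  next
    case Empty then show ?case by simp
  next
    case (Compl A)
    have "Some ` (UNIV - A) = Some ` UNIV - Some ` A" by auto
    then show ?case using Compl *[OF open_UNIV] by (simp add: sets.Diff)
  next
    case (Union A)
    then show ?case by (simp add: image_UN sets.countable_UN')
  qed
qed

lemma None_sets_ecborel: "{None} \<in> sets ecborel"
proof -
  have "{None} = space ecborel - Some ` UNIV"
    by (auto simp: ecborel_def space_measure_of_conv) (metis not_None_eq rangeI)
  then show ?thesis
    using sets_ecborel_image_Some[of UNIV] by (simp add: sets.compl_sets)
qed

text \<open>So measurability means measurability of the set where the value is infinite and of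
  the finite part.\<close>

lemma measurable_ecborel_iff:
  "f \<in> M \<rightarrow>\<^sub>M ecborel \<longleftrightarrow> {x \<in> space M. f x = None} \<in> sets M \<and>
     (\<forall>B\<in>sets borel. {x \<in> space M. f x \<in> Some ` B} \<in> sets M)" (is "?L \<longleftrightarrow> ?R")
proof
  assume f: ?L
  have "{x \<in> space M. f x \<in> A} \<in> sets M" if "A \<in> sets ecborel" for A
    using measurable_sets[OF f that] by (simp add: vimage_def Int_def conj_commute)
  from this[OF None_sets_ecborel] this[OF sets_ecborel_image_Some] show ?R
    by simp
next
  assume R: ?R
  have "{x \<in> space M. f x \<in> V} \<in> sets M"
    if V: "openin (Alexandroff_compactification euclidean) V" for V
    using V unfolding openin_Alexandroff_compactification
  proof (elim disjE exE conjE)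
    fix U assume "openin euclidean U" "V = Some ` U"
    then show ?thesis using R by (auto simp flip: open_openin)
  next
    fix C assume C: "closedin euclidean C" "V = insert None (Some ` (topspace euclidean - C))"
    then have "- C \<in> sets borel" by (auto simp flip: closed_closedin)
    moreover have "{x \<in> space M. f x \<in> V} =
        {x \<in> space M. f x = None} \<union> {x \<in> space M. f x \<in> Some ` (- C)}"
      using C by (auto simp: Compl_eq_Diff_UNIV)
    ultimately show ?thesis using R by auto
  qed
  then show ?L
    unfolding ecborel_def by (intro measurable_measure_of) (simp_all add: vimage_def Int_def conj_commute)
qed

definition ecabs :: "ecomplex \<Rightarrow> ennreal" where
  "ecabs w = (case w of None \<Rightarrow> \<infinity> | Some z \<Rightarrow> ennreal (cmod z))"

text \<open>The inclusion of \<open>[0, \<infinity>]\<close>.\<close>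

definition ec_of_ennreal :: "ennreal \<Rightarrow> ecomplex" where
  "ec_of_ennreal t = (if t = \<infinity> then None else Some (of_real (enn2real t)))"

text \<open>Scaling obeys the convention \<open>0 * \<infinity> = 0\<close>.\<close>

definition ecscale :: "complex \<Rightarrow> ecomplex \<Rightarrow> ecomplex" where
  "ecscale a w = (case w of None \<Rightarrow> (if a = 0 then Some 0 else None) | Some z \<Rightarrow> Some (a * z))"

text \<open>Differences are only taken between functions of finite quasinorm. These are finite almost
  everywhere, so the value chosen when an argument is infinite is immaterial.\<close>

definition ecdiff :: "ecomplex \<Rightarrow> ecomplex \<Rightarrow> ecomplex" where
  "ecdiff v w = (case (v, w) of (Some y, Some z) \<Rightarrow> Some (y - z) | _ \<Rightarrow> None)"

definition ae_rel :: "(('a::euclidean_space \<Rightarrow> ecomplex) \<times> ('a \<Rightarrow> ecomplex)) set" where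
  "ae_rel = {(f, g). f \<in> lebesgue \<rightarrow>\<^sub>M ecborel \<and> g \<in> lebesgue \<rightarrow>\<^sub>M ecborel \<and>
     (AE x in lebesgue. f x = g x)}"

definition ae_class :: "('a::euclidean_space \<Rightarrow> ecomplex) \<Rightarrow> ('a \<Rightarrow> ecomplex) set" where
  "ae_class f = ae_rel `` {f}"

definition meas_funs :: "('a::euclidean_space \<Rightarrow> ecomplex) set set" where
  "meas_funs = (lebesgue \<rightarrow>\<^sub>M ecborel) // ae_rel"

lemma equiv_ae_rel: "equiv (lebesgue \<rightarrow>\<^sub>M ecborel) ae_rel"
  by (rule equivI) (auto simp: ae_rel_def refl_on_def sym_def trans_def)

lemma ae_class_in_meas_funs_iff: "ae_class f \<in> meas_funs \<longleftrightarrow> f \<in> lebesgue \<rightarrow>\<^sub>M ecborel"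
proof
  assume "ae_class f \<in> meas_funs"
  then have "ae_class f \<noteq> {}"
    unfolding meas_funs_def using in_quotient_imp_non_empty[OF equiv_ae_rel] by blast
  then show "f \<in> lebesgue \<rightarrow>\<^sub>M ecborel"
    by (auto simp: ae_class_def ae_rel_def)
qed (auto simp: ae_class_def meas_funs_def quotient_def)

text \<open>The class in \<open>meas_funs\<close> of a \<open>[0, \<infinity>]\<close>-valued function; for Lebesgue measurable \<open>f\<close>
  these are exactly the elements of \<open>M\<^sub>+\<close>.\<close>

definition pos_class :: "('a::euclidean_space \<Rightarrow> ennreal) \<Rightarrow> ('a \<Rightarrow> ecomplex) set" where
  "pos_class f = ae_class (\<lambda>x. ec_of_ennreal (f x))"

text \<open>\<open>N\<close> is a map on classes; its values outside \<open>meas_funs\<close> play no role.\<close>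

locale quasi_banach_function_norm =
  fixes N :: "('a::euclidean_space \<Rightarrow> ecomplex) set \<Rightarrow> ennreal"
  assumes norm_abs:
      "\<And>f. f \<in> lebesgue \<rightarrow>\<^sub>M ecborel \<Longrightarrow> N (pos_class (\<lambda>x. ecabs (f x))) = N (ae_class f)"
    and Q1a: "\<And>a f. f \<in> borel_measurable lebesgue \<Longrightarrow>
      N (ae_class (\<lambda>x. ecscale a (ec_of_ennreal (f x)))) = ennreal (cmod a) * N (pos_class f)"
    and Q1b: "\<And>f. f \<in> borel_measurable lebesgue \<Longrightarrow>
      N (pos_class f) = 0 \<longleftrightarrow> (AE x in lebesgue. f x = 0)"
    and Q1c: "\<exists>C::real. C \<ge> 1 \<and>
      (\<forall>f\<in>borel_measurable lebesgue. \<forall>g\<in>borel_measurable lebesgue.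
        N (pos_class (\<lambda>x. f x + g x)) \<le> ennreal C * (N (pos_class f) + N (pos_class g)))"
    and P2: "\<And>f g. f \<in> borel_measurable lebesgue \<Longrightarrow> g \<in> borel_measurable lebesgue \<Longrightarrow>
      (AE x in lebesgue. f x \<le> g x) \<Longrightarrow> N (pos_class f) \<le> N (pos_class g)"
    and P3: "\<And>(f :: nat \<Rightarrow> 'a \<Rightarrow> ennreal) g.
      (\<And>k. f k \<in> borel_measurable lebesgue) \<Longrightarrow> g \<in> borel_measurable lebesgue \<Longrightarrow>
      (AE x in lebesgue. incseq (\<lambda>k. f k x) \<and> (\<lambda>k. f k x) \<longlonglongrightarrow> g x) \<Longrightarrow>
      incseq (\<lambda>k. N (pos_class (f k))) \<and> (\<lambda>k. N (pos_class (f k))) \<longlonglongrightarrow> N (pos_class g)"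
    and P4: "\<And>E. E \<in> sets lebesgue \<Longrightarrow> emeasure lebesgue E < \<infinity> \<Longrightarrow>
      N (pos_class (indicator E)) < \<infinity>"

definition qbfs :: "(('a::euclidean_space \<Rightarrow> ecomplex) set \<Rightarrow> ennreal) \<Rightarrow> ('a \<Rightarrow> ecomplex) set set"
  where "qbfs N = {F \<in> meas_funs. N F < \<infinity>}"

text \<open>A set is open if it contains with each of its points a quasinorm ball around that point.
  (The balls themselves need not be open.)\<close>

definition qbfs_open ::
    "(('a::euclidean_space \<Rightarrow> ecomplex) set \<Rightarrow> ennreal) \<Rightarrow> ('a \<Rightarrow> ecomplex) set set \<Rightarrow> bool" where
  "qbfs_open N U \<longleftrightarrow> U \<subseteq> qbfs N \<and>
     (\<forall>f. ae_class f \<in> U \<longrightarrow>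
       (\<exists>e::real. e > 0 \<and>
         (\<forall>g. ae_class g \<in> qbfs N \<and> N (ae_class (\<lambda>x. ecdiff (g x) (f x))) < ennreal e
              \<longrightarrow> ae_class g \<in> U)))"

definition qbfs_topology ::
    "(('a::euclidean_space \<Rightarrow> ecomplex) set \<Rightarrow> ennreal) \<Rightarrow> ('a \<Rightarrow> ecomplex) set topology" where
  "qbfs_topology N = topology (qbfs_open N)"

lemma istopology_qbfs_open: "istopology (qbfs_open N)"
proof -
  have "qbfs_open N (S \<inter> T)" if S: "qbfs_open N S" and T: "qbfs_open N T" for S T
    unfolding qbfs_open_def
  proof (intro conjI allI impI)
    show "S \<inter> T \<subseteq> qbfs N"
      using S by (auto simp: qbfs_open_def)
    fix f assume f: "ae_class f \<in> S \<inter> T"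
    obtain d where d: "d > 0"
      "\<And>g. ae_class g \<in> qbfs N \<Longrightarrow> N (ae_class (\<lambda>x. ecdiff (g x) (f x))) < ennreal d \<Longrightarrow> ae_class g \<in> S"
      using S f unfolding qbfs_open_def by blast
    obtain e where e: "e > 0"
      "\<And>g. ae_class g \<in> qbfs N \<Longrightarrow> N (ae_class (\<lambda>x. ecdiff (g x) (f x))) < ennreal e \<Longrightarrow> ae_class g \<in> T"
      using T f unfolding qbfs_open_def by blast
    have "ennreal (min d e) \<le> ennreal d" "ennreal (min d e) \<le> ennreal e"
      by (auto intro: ennreal_leI)
    then have "ae_class g \<in> S \<inter> T" if "ae_class g \<in> qbfs N"
      "N (ae_class (\<lambda>x. ecdiff (g x) (f x))) < ennreal (min d e)" for g
      using that d(2)[of g] e(2)[of g] by (blast intro: order.strict_trans2)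
    with d(1) e(1) show "\<exists>c::real. c > 0 \<and>
         (\<forall>g. ae_class g \<in> qbfs N \<and> N (ae_class (\<lambda>x. ecdiff (g x) (f x))) < ennreal c
              \<longrightarrow> ae_class g \<in> S \<inter> T)"
      by (intro exI[of _ "min d e"]) auto
  qed
  moreover have "qbfs_open N (\<Union>\<K>)" if "\<forall>K\<in>\<K>. qbfs_open N K" for \<K>
    using that unfolding qbfs_open_def by (smt (verit) Sup_le_iff UnionE UnionI)
  ultimately show ?thesis
    unfolding istopology_def by blast
qed

lemma openin_qbfs_topology [simp]: "openin (qbfs_topology N) U \<longleftrightarrow> qbfs_open N U"
  unfolding qbfs_topology_def by (simp add: topology_inverse'[OF istopology_qbfs_open])

lemma topspace_qbfs_topology [simp]: "topspace (qbfs_topology N) = qbfs N"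
proof
  show "topspace (qbfs_topology N) \<subseteq> qbfs N"
    by (auto simp: topspace_def qbfs_open_def)
  have "qbfs_open N (qbfs N)"
    unfolding qbfs_open_def by (auto intro: exI[of _ 1])
  then show "qbfs N \<subseteq> topspace (qbfs_topology N)"
    by (auto simp: topspace_def)
qed

definition absolutely_continuous_at ::
    "(('a::euclidean_space \<Rightarrow> ecomplex) set \<Rightarrow> ennreal) \<Rightarrow> ('a \<Rightarrow> ecomplex) \<Rightarrow> bool" where
  "absolutely_continuous_at N f \<longleftrightarrow>
     (\<forall>E :: nat \<Rightarrow> 'a set.
        (\<forall>k. E k \<in> sets lebesgue) \<and>
        (AE x in lebesgue. (\<lambda>k. indicator (E k) x :: real) \<longlonglongrightarrow> 0) \<longrightarrow>
        (\<lambda>k. N (ae_class (\<lambda>x. ecscale (indicator (E k) x) (f x)))) \<longlonglongrightarrow> 0)"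

definition absolutely_continuous_quasinorm ::
    "(('a::euclidean_space \<Rightarrow> ecomplex) set \<Rightarrow> ennreal) \<Rightarrow> bool" where
  "absolutely_continuous_quasinorm N \<longleftrightarrow>
     (\<forall>f. ae_class f \<in> qbfs N \<longrightarrow> absolutely_continuous_at N f)"

end

theory Submission
  imports Defs
begin

text \<open>A function that is not absolutely continuous yields, by the Fatou property, infinitely many
  disjoint sets \<open>G i\<close> on each of which it has quasinorm at least \<open>e > 0\<close>. Its restrictions to
  the unions over \<open>i \<in> S\<close>, for \<open>S\<close> a set of naturals, form an uncountable
  \<open>e\<close>-separated family, so the space is not separable. Conversely, absolute continuity of the
  quasinorm gives dominated convergence. A function in the space is then approximated by
  truncations, these by clipped continuous functions converging almost everywhere, and those by
  a countable family of step functions.\<close>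

section \<open>Extended complex values and their classes\<close>

text \<open>The axioms concern nonnegative functions while the quasinorm lives on classes, so all
  estimates are carried out for a functional \<open>rho\<close> on functions with values in
  \<open>ennreal\<close>. Finite quasinorm forces finiteness almost everywhere, which lets
  complex-valued differences replace extended ones. Two obstacles shape the argument. The triangle
  inequality carries a factor \<open>C\<close>, so tolerances have the form
  \<open>e / (2 * C)\<close>; and since density speaks of open sets only, an open set has to be
  found inside each quasinorm ball before a dense set can be used. Moreover, the axioms offer no
  comparison with an integral norm, so density of continuous functions cannot be borrowed from an
  L^1 space. What is available is convergence almost everywhere, and it becomes quasinorm
  convergence only under a common dominating function of finite quasinorm. This is why approximants
  are clipped in value and cut off to a ball: there P4 supplies the dominating function.\<close>

definition ecfin :: "ecomplex \<Rightarrow> complex" where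
  "ecfin w = (case w of None \<Rightarrow> 0 | Some z \<Rightarrow> z)"

lemma ecfin_Some [simp]: "ecfin (Some z) = z"
  by (simp add: ecfin_def)

lemma space_ecborel [simp]: "space ecborel = UNIV"
  by (simp add: ecborel_def space_measure_of_conv)

lemma pred_eq_None [measurable]: "Measurable.pred ecborel (\<lambda>w. w = None)"
  using None_sets_ecborel by (simp add: pred_def)

lemma measurable_Some_ecborel [measurable]: "Some \<in> borel \<rightarrow>\<^sub>M ecborel"
  by (auto simp: measurable_ecborel_iff inj_image_mem_iff)

lemma measurable_ecfin [measurable]: "ecfin \<in> ecborel \<rightarrow>\<^sub>M borel"
proof (rule measurableI)
  fix B :: "complex set" assume B: "B \<in> sets borel"
  have "ecfin -` B \<inter> space ecborel = Some ` B \<union> (if 0 \<in> B then {None} else {})"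
    by (auto simp: ecfin_def split: option.splits)
  then show "ecfin -` B \<inter> space ecborel \<in> sets ecborel"
    using sets_ecborel_image_Some[OF B] None_sets_ecborel by (simp add: sets.Un del: Un_insert_right)
qed simp

text \<open>Case analysis on option values is traded for a test for \<open>None\<close> and the
  Borel function \<open>ecfin\<close>, a shape in which measurability can be proved automatically.
  The next two lemmas serve the same end.\<close>

lemma ecabs_alt: "ecabs w = (if w = None then \<infinity> else ennreal (cmod (ecfin w)))"
  by (auto simp: ecabs_def ecfin_def split: option.splits)

lemma ecdiff_alt:
  "ecdiff v w = (if v = None \<or> w = None then None else Some (ecfin v - ecfin w))"
  by (auto simp: ecdiff_def ecfin_def split: option.splits)

lemma ecscale_alt:
  "ecscale a w = (if w = None \<and> a \<noteq> 0 then None else Some (a * ecfin w))"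
  by (auto simp: ecscale_def ecfin_def split: option.splits)

lemma measurable_ecabs [measurable]: "ecabs \<in> borel_measurable ecborel"
  unfolding ecabs_alt[abs_def] by measurable

lemma measurable_ec_of_ennreal [measurable]: "ec_of_ennreal \<in> borel \<rightarrow>\<^sub>M ecborel"
  unfolding ec_of_ennreal_def[abs_def] by measurable

lemma measurable_ecdiff [measurable (raw)]:
  assumes [measurable]: "f \<in> M \<rightarrow>\<^sub>M ecborel" "g \<in> M \<rightarrow>\<^sub>M ecborel"
  shows "(\<lambda>x. ecdiff (f x) (g x)) \<in> M \<rightarrow>\<^sub>M ecborel"
  unfolding ecdiff_alt by measurable

lemma measurable_ecscale [measurable (raw)]:
  assumes [measurable]: "a \<in> borel_measurable M" "f \<in> M \<rightarrow>\<^sub>M ecborel"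
  shows "(\<lambda>x. ecscale (a x) (f x)) \<in> M \<rightarrow>\<^sub>M ecborel"
  unfolding ecscale_alt by measurable

lemma ecabs_Some [simp]: "ecabs (Some z) = ennreal (cmod z)"
  by (simp add: ecabs_def)

lemma ecabs_ec_of_ennreal [simp]: "ecabs (ec_of_ennreal t) = t"
  by (cases t) (auto simp: ecabs_def ec_of_ennreal_def)

lemma ecabs_ecscale: "ecabs (ecscale a w) = ennreal (cmod a) * ecabs w"
  by (auto simp: ecscale_def ennreal_mult norm_mult ennreal_mult_top ecabs_def split: option.splits)

text \<open>The conventions for zero times infinity agree on both sides. This turns Q1a into
  homogeneity of \<open>rho\<close>.\<close>

lemma ecscale_ec_of_ennreal:
  assumes "c \<ge> 0"
  shows "ecscale (of_real c) (ec_of_ennreal t) = ec_of_ennreal (ennreal c * t)"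
  using assms
  by (cases t) (auto simp: ecscale_def ec_of_ennreal_def ennreal_mult_top ennreal_mult[symmetric])

lemma ecabs_ecdiff_commute: "ecabs (ecdiff v w) = ecabs (ecdiff w v)"
  by (auto simp: ecdiff_def ecabs_def norm_minus_commute split: option.splits)

text \<open>If any of the three values is infinite, so is the right-hand side; otherwise this is the
  triangle inequality for complex numbers.\<close>

lemma ecabs_ecdiff_triangle:
  "ecabs (ecdiff u w) \<le> ecabs (ecdiff u v) + ecabs (ecdiff v w)"
proof -
  have "cmod (a - c) \<le> cmod (a - b) + cmod (b - c)" for a b c :: complex
    using norm_triangle_ineq[of "a - b" "b - c"] by simp
  then show ?thesis
    by (auto simp: ecdiff_def ecabs_def simp flip: ennreal_plus split: option.splits)
qed

lemma ae_class_mem: "f \<in> lebesgue \<rightarrow>\<^sub>M ecborel \<Longrightarrow> f \<in> ae_class f"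
  by (simp add: ae_class_def ae_rel_def)

lemma ae_class_eqD:
  assumes "ae_class f = ae_class g" "f \<in> lebesgue \<rightarrow>\<^sub>M ecborel"
  shows "AE x in lebesgue. f x = g x"
  using ae_class_mem[OF assms(2)] unfolding assms(1)
  by (auto simp: ae_class_def ae_rel_def elim: eventually_mono)

lemma meas_funs_obtain:
  assumes "F \<in> meas_funs"
  obtains f where "f \<in> lebesgue \<rightarrow>\<^sub>M ecborel" "F = ae_class f"
  using assms by (auto simp: meas_funs_def ae_class_def elim: quotientE)

lemma ae_class_in_qbfs_iff:
  "ae_class f \<in> qbfs N \<longleftrightarrow> f \<in> lebesgue \<rightarrow>\<^sub>M ecborel \<and> N (ae_class f) < \<infinity>"
  by (simp add: qbfs_def ae_class_in_meas_funs_iff)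

section \<open>The quasinorm as a functional on nonnegative functions\<close>

context quasi_banach_function_norm
begin

text \<open>The quasinorm restricted to the nonnegative cone, taking functions instead of classes.
  By \<open>norm_abs\<close> it determines \<open>N\<close> on all of
  \<open>meas_funs\<close>.\<close>

definition rho :: "('a \<Rightarrow> ennreal) \<Rightarrow> ennreal" where
  "rho u = N (pos_class u)"

lemma N_eq_rho:
  assumes "f \<in> lebesgue \<rightarrow>\<^sub>M ecborel"
  shows "N (ae_class f) = rho (\<lambda>x. ecabs (f x))"
  using norm_abs[OF assms] by (simp add: rho_def)

lemma rho_mono_AE:
  assumes "u \<in> borel_measurable lebesgue" "v \<in> borel_measurable lebesgue"
    and "AE x in lebesgue. u x \<le> v x"
  shows "rho u \<le> rho v"
  using P2[OF assms] by (simp add: rho_def)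

lemma rho_cong_AE:
  assumes "u \<in> borel_measurable lebesgue" "v \<in> borel_measurable lebesgue"
    and "AE x in lebesgue. u x = v x"
  shows "rho u = rho v"
  using assms by (intro antisym rho_mono_AE) auto

lemma rho_cmult:
  assumes "u \<in> borel_measurable lebesgue" "c \<ge> 0"
  shows "rho (\<lambda>x. ennreal c * u x) = ennreal c * rho u"
  using Q1a[OF assms(1), of "of_real c"] assms(2)
  by (simp add: rho_def pos_class_def ecscale_ec_of_ennreal)

lemma rho_triangle:
  obtains C :: real where "C \<ge> 1"
    "\<And>u v. u \<in> borel_measurable lebesgue \<Longrightarrow> v \<in> borel_measurable lebesgue \<Longrightarrow>
      rho (\<lambda>x. u x + v x) \<le> ennreal C * (rho u + rho v)"
  using Q1c unfolding rho_def by blast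

lemma rho_bounded_finite:
  assumes u: "u \<in> borel_measurable lebesgue" and B: "B \<in> sets lebesgue" "emeasure lebesgue B < \<infinity>"
    and "K \<ge> 0" "\<And>x. u x \<le> ennreal K * indicator B x"
  shows "rho u < \<infinity>"
proof -
  have "rho u \<le> rho (\<lambda>x. ennreal K * indicator B x)"
    using assms by (intro rho_mono_AE) auto
  also have "\<dots> = ennreal K * rho (indicator B)"
    using assms by (intro rho_cmult) auto
  also have "\<dots> < \<infinity>"
    using P4[OF B] by (simp add: rho_def ennreal_mult_less_top)
  finally show ?thesis .
qed

text \<open>On the set where \<open>u\<close> is infinite, \<open>2 * u = u\<close>.\<close>

lemma AE_finite:
  assumes [measurable]: "u \<in> borel_measurable lebesgue" and fin: "rho u < \<infinity>"
  shows "AE x in lebesgue. u x < \<infinity>"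
proof -
  define v :: "'a \<Rightarrow> ennreal" where "v x = (if u x = \<infinity> then \<infinity> else 0)" for x
  have [measurable]: "v \<in> borel_measurable lebesgue"
    unfolding v_def by measurable
  have "rho v \<le> rho u"
    by (intro rho_mono_AE) (auto simp: v_def)
  with fin have "rho v < \<infinity>" by simp
  have "(\<lambda>x. ennreal 2 * v x) = v"
    by (auto simp: v_def fun_eq_iff ennreal_mult_top)
  then have "rho v = ennreal 2 * rho v"
    using rho_cmult[of v 2] by simp
  with \<open>rho v < \<infinity>\<close> have "rho v = 0"
    by (cases "rho v") (auto simp: ennreal_mult[symmetric] simp del: ennreal_numeral)
  then have "AE x in lebesgue. v x = 0"
    using Q1b[of v] by (simp add: rho_def)
  then show ?thesis
    by eventually_elim (auto simp: v_def less_top split: if_splits)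
qed

lemma AE_not_None:
  assumes "ae_class f \<in> qbfs N"
  shows "AE x in lebesgue. f x \<noteq> None"
proof -
  have [measurable]: "f \<in> lebesgue \<rightarrow>\<^sub>M ecborel" and "rho (\<lambda>x. ecabs (f x)) < \<infinity>"
    using assms by (auto simp: ae_class_in_qbfs_iff N_eq_rho)
  then have "AE x in lebesgue. ecabs (f x) < \<infinity>"
    by (intro AE_finite) auto
  then show ?thesis
  proof eventually_elim
    case (elim x)
    then show ?case by (cases "f x") (simp_all add: ecabs_def)
  qed
qed

end

section \<open>A countable family of step functions\<close>

lemma ennreal_tendsto_0_iff:
  fixes f :: "'b \<Rightarrow> ennreal"
  shows "(f \<longlongrightarrow> 0) F \<longleftrightarrow> (\<forall>e>0. \<forall>\<^sub>F x in F. f x < ennreal e)" (is "?L \<longleftrightarrow> ?R")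
proof
  assume ?L
  then show ?R by (auto intro: order_tendstoD(2))
next
  assume R: ?R
  show ?L
  proof (rule order_tendstoI)
    fix a :: ennreal assume "0 < a"
    then obtain e :: real where e: "0 < e" "ennreal e \<le> a"
      by (cases a) (auto intro: that[of 1])
    with R show "\<forall>\<^sub>F x in F. f x < a"
      by (auto elim!: eventually_mono intro: less_le_trans)
  qed simp
qed

lemma indicator_tendsto_0_iff:
  "((\<lambda>k. indicator (E k) x :: real) \<longlongrightarrow> 0) F \<longleftrightarrow> (\<forall>\<^sub>F k in F. x \<notin> E k)" (is "?L \<longleftrightarrow> ?R")
proof
  assume ?L
  then have "\<forall>\<^sub>F k in F. indicator (E k) x < (1::real)"
    by (rule order_tendstoD) simp
  then show ?R
    by (rule eventually_mono) (auto split: split_indicator_asm)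
next
  assume ?R
  then have "\<forall>\<^sub>F k in F. indicator (E k) x = (0::real)"
    by (rule eventually_mono) simp
  then show ?L by (rule tendsto_eventually)
qed

lemma dense_sequence:
  obtains d :: "nat \<Rightarrow> 'b :: {metric_space, second_countable_topology}"
  where "\<And>x e. e > 0 \<Longrightarrow> \<exists>i. dist x (d i) < e"
proof -
  obtain D :: "'b set" where D: "countable D" "\<And>X. open X \<Longrightarrow> X \<noteq> {} \<Longrightarrow> \<exists>d\<in>D. d \<in> X"
    using countable_dense_exists by blast
  have "\<exists>i. dist x (from_nat_into D i) < e" if "e > 0" for x e
  proof -
    obtain y where "y \<in> D" "y \<in> ball x e"
      using D(2)[of "ball x e"] \<open>e > 0\<close> by (metis centre_in_ball empty_iff open_ball)
    with D(1) show ?thesis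
      by (metis from_nat_into_surj mem_ball)
  qed
  then show ?thesis by (rule that)
qed

text \<open>A step function on \<open>cball 0 k\<close> takes the value with number \<open>q ! i\<close> at \<open>x\<close>, where \<open>i\<close> is
  the number of the first point of a dense sequence at distance less than \<open>1 / (m + 1)\<close>
  from \<open>x\<close>. Encoding the values by a list of naturals makes the family countable.\<close>

lemma countable_step_functions:
  obtains D :: "('a::euclidean_space \<Rightarrow> complex) set" where "countable D"
    "\<And>d. d \<in> D \<Longrightarrow> d \<in> borel_measurable lebesgue"
    "\<And>d. d \<in> D \<Longrightarrow> \<exists>K\<ge>0. \<exists>k. \<forall>x. cmod (d x) \<le> K * indicator (cball 0 k) x"
    "\<And>(g :: 'a \<Rightarrow> complex) (k :: nat) K. continuous_on UNIV g \<Longrightarrow> (\<And>x. cmod (g x) \<le> K) \<Longrightarrow>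
      \<exists>s. (\<forall>m. s m \<in> D) \<and> (\<forall>m x. cmod (s m x) \<le> (K + 1) * indicator (cball 0 k) x) \<and>
        (\<forall>x\<in>cball 0 k. (\<lambda>m. s m x) \<longlonglongrightarrow> g x)"
proof -
  obtain d :: "nat \<Rightarrow> 'a" where d: "\<And>x e. e > 0 \<Longrightarrow> \<exists>i. dist x (d i) < e"
    using dense_sequence by blast
  obtain c :: "nat \<Rightarrow> complex" where c: "\<And>x e. e > 0 \<Longrightarrow> \<exists>i. dist x (c i) < e"
    using dense_sequence by blast
  \<comment> \<open>Taking the least admissible index makes the choice of a nearby point
    measurable.\<close>
  define idx where "idx m x = (LEAST i. dist x (d i) < inverse (real (Suc m)))" for m x
  have dist_idx: "dist x (d (idx m x)) < inverse (real (Suc m))" for m x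
    unfolding idx_def by (rule LeastI_ex) (simp add: d)
  have [measurable]: "idx m \<in> borel \<rightarrow>\<^sub>M count_space UNIV" for m
    unfolding idx_def[abs_def] by measurable
  \<comment> \<open>The value 0 beyond the end of \<open>q\<close> makes every finite list describe
    a bounded function.\<close>
  define step where "step = (\<lambda>(k, m, q) x.
    if norm x \<le> real k \<and> idx m x < length q then c (q ! idx m x) else 0)"
  define D where "D = range step"
  show ?thesis
  proof (rule that)
    show "countable D" by (simp add: D_def)
    show "f \<in> borel_measurable lebesgue" if "f \<in> D" for f
    proof -
      obtain k m q where f: "f = step (k, m, q)"
        using \<open>f \<in> D\<close> by (auto simp: D_def)
      have "f \<in> borel_measurable borel"
        unfolding f step_def split by measurable
      then show ?thesis
        by (intro measurable_completion) simp
    qed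
    show "\<exists>K\<ge>0. \<exists>k. \<forall>x. cmod (f x) \<le> K * indicator (cball 0 k) x" if "f \<in> D" for f
    proof -
      obtain k m q where f: "f = step (k, m, q)"
        using \<open>f \<in> D\<close> by (auto simp: D_def)
      \<comment> \<open>The sum serves as an upper bound for the maximum and also covers the empty
        list.\<close>
      define K where "K = (\<Sum>i<length q. cmod (c (q ! i)))"
      have "cmod (f x) \<le> K * indicator (cball 0 (real k)) x" for x
        by (auto simp: f step_def K_def sum_nonneg intro!: member_le_sum
          split: split_indicator)
      moreover have "K \<ge> 0" by (simp add: K_def sum_nonneg)
      ultimately show ?thesis by blast
    qed
    fix g :: "'a \<Rightarrow> complex" and k :: nat and K :: real
    assume cont: "continuous_on UNIV g" and K: "\<And>x. cmod (g x) \<le> K"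
    \<comment> \<open>Compactness: finitely many of the small balls cover \<open>cball 0 k\<close>,
      so only finitely many indices occur there and a finite list can record all values.\<close>
    have "\<exists>L. \<forall>x\<in>cball 0 (real k). idx m x < L" for m
    proof -
      have "cball 0 (real k) \<subseteq> (\<Union>i\<in>UNIV. ball (d i) (inverse (real (Suc m))))"
        using d[of "inverse (real (Suc m))"] by (auto simp: dist_commute)
      then obtain J where J: "finite J" "cball 0 (real k) \<subseteq> (\<Union>i\<in>J. ball (d i) (inverse (real (Suc m))))"
        using compactE_image[OF compact_cball, of UNIV "\<lambda>i. ball (d i) (inverse (real (Suc m)))"]
        by (metis open_ball)
      have "idx m x < Suc (Max J)" if "x \<in> cball 0 (real k)" for x
      proof -
        obtain i where i: "i \<in> J" "dist x (d i) < inverse (real (Suc m))"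
          using J(2) \<open>x \<in> cball 0 (real k)\<close> by (force simp: dist_commute)
        have "idx m x \<le> i"
          unfolding idx_def using i(2) by (rule Least_le)
        also have "i \<le> Max J" using i(1) J(1) by simp
        finally show ?thesis by simp
      qed
      then show ?thesis by blast
    qed
    then obtain L where L: "\<And>m x. norm x \<le> real k \<Longrightarrow> idx m x < L m"
      by (simp add: Ball_def) metis
    have "\<forall>m i. \<exists>r. dist (g (d i)) (c r) < inverse (real (Suc m))"
      by (intro allI c) simp
    then obtain r where r: "\<And>m i. dist (g (d i)) (c (r m i)) < inverse (real (Suc m))"
      by (auto simp only: choice_iff simp_thms)
    define s where "s m = step (k, m, map (r m) [0..<L m])" for m
    have s: "s m x = (if norm x \<le> real k then c (r m (idx m x)) else 0)" for m x
      using L[of x m] by (simp add: s_def step_def)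
    have "s m \<in> D" for m
      by (simp add: s_def D_def)
    \<comment> \<open>The extra 1 absorbs the error of at most \<open>1 / (m + 1)\<close> made by
      replacing values of \<open>g\<close> by members of the dense sequence
      \<open>c\<close>.\<close>
    moreover have "cmod (s m x) \<le> (K + 1) * indicator (cball 0 (real k)) x" for m x
    proof -
      let ?a = "g (d (idx m x))" and ?b = "c (r m (idx m x))"
      have "cmod ?b \<le> cmod ?a + dist ?a ?b"
        by (metis dist_norm norm_triangle_sub norm_minus_commute)
      also have "\<dots> \<le> K + inverse (real (Suc m))"
        by (intro add_mono K less_imp_le r)
      also have "\<dots> \<le> K + 1"
        by (simp add: field_simps)
      finally show ?thesis
        by (simp add: s indicator_def)
    qed
    moreover have "(\<lambda>m. s m x) \<longlonglongrightarrow> g x" if x: "x \<in> cball 0 (real k)" for x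
    proof -
      have "(\<lambda>m. dist (d (idx m x)) x) \<longlonglongrightarrow> 0"
        by (rule tendsto_sandwich[OF _ _ tendsto_const LIMSEQ_inverse_real_of_nat])
          (auto intro!: always_eventually less_imp_le dist_idx simp: dist_commute simp del: of_nat_Suc)
      then have "(\<lambda>m. d (idx m x)) \<longlonglongrightarrow> x"
        by (subst tendsto_dist_iff)
      then have 1: "(\<lambda>m. g (d (idx m x))) \<longlonglongrightarrow> g x"
        by (intro continuous_on_tendsto_compose[OF cont]) auto
      have "(\<lambda>m. dist (s m x) (g (d (idx m x)))) \<longlonglongrightarrow> 0"
        by (rule tendsto_sandwich[OF _ _ tendsto_const LIMSEQ_inverse_real_of_nat])
          (use x in \<open>auto intro!: always_eventually less_imp_le r simp: s dist_commute simp del: of_nat_Suc\<close>)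
      then have "(\<lambda>m. s m x - g (d (idx m x))) \<longlonglongrightarrow> 0"
        by (subst (asm) dist_norm) (rule tendsto_norm_zero_cancel)
      with 1 show ?thesis by (rule Lim_transform)
    qed
    ultimately show "\<exists>s. (\<forall>m. s m \<in> D) \<and>
        (\<forall>m x. cmod (s m x) \<le> (K + 1) * indicator (cball 0 (real k)) x) \<and>
        (\<forall>x\<in>cball 0 (real k). (\<lambda>m. s m x) \<longlonglongrightarrow> g x)"
      by blast
  qed
qed

section \<open>Dominated convergence\<close>

text \<open>Explains the tolerance \<open>e / (2 * C)\<close>: two errors below it, added by the
  quasi-triangle inequality with modulus \<open>C\<close>, stay below \<open>e\<close>.\<close>

lemma ennreal_half_half_less:
  assumes "C \<ge> 1" "x < ennreal (e / (2 * C))" "y < ennreal (e / (2 * C))"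
  shows "ennreal C * (x + y) < ennreal e"
proof -
  obtain a b where ab: "x = ennreal a" "y = ennreal b" "a \<ge> 0" "b \<ge> 0"
    using assms(2,3) by (cases x; cases y) auto
  with assms have "a < e / (2 * C)" "b < e / (2 * C)"
    by (auto simp: ennreal_less_iff)
  then have "C * (a + b) < e"
    using assms(1) by (simp add: field_simps)
  then show ?thesis
    using ab assms(1) by (simp add: ennreal_less_iff flip: ennreal_plus ennreal_mult)
qed

context quasi_banach_function_norm
begin

lemma absolutely_continuous_at_iff:
  assumes [measurable]: "f \<in> lebesgue \<rightarrow>\<^sub>M ecborel"
  shows "absolutely_continuous_at N f \<longleftrightarrow>
    (\<forall>E. (\<forall>k. E k \<in> sets lebesgue) \<and> (AE x in lebesgue. \<forall>\<^sub>F k in sequentially. x \<notin> E k) \<longrightarrow>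
      (\<lambda>k. rho (\<lambda>x. indicator (E k) x * ecabs (f x))) \<longlonglongrightarrow> 0)"
proof -
  have "N (ae_class (\<lambda>x. ecscale (indicator E x) (f x))) = rho (\<lambda>x. indicator E x * ecabs (f x))"
    if [measurable]: "E \<in> sets lebesgue" for E
  proof -
    have "ennreal (cmod (indicator E x)) = indicator E x" for x
      by (simp split: split_indicator)
    then show ?thesis
      by (subst N_eq_rho) (simp_all add: ecabs_ecscale)
  qed
  then show ?thesis
    unfolding absolutely_continuous_at_def indicator_tendsto_0_iff by (auto simp: cong: all_cong)
qed

text \<open>Let \<open>E j\<close> be the set where \<open>u j\<close> exceeds \<open>d * v\<close>.
  Off \<open>E j\<close> the function is at most \<open>d * v\<close>, which is small in quasinorm
  for small \<open>d\<close>. On \<open>E j\<close> it is at most \<open>v\<close>, and almost every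
  point eventually leaves these sets, so absolute continuity at \<open>v\<close> makes that part
  small as well.\<close>

lemma rho_dominated_convergence:
  fixes u :: "nat \<Rightarrow> 'a \<Rightarrow> ennreal"
  assumes ac: "absolutely_continuous_quasinorm N"
    and [measurable]: "\<And>j. u j \<in> borel_measurable lebesgue" "v \<in> borel_measurable lebesgue"
    and v: "rho v < \<infinity>"
    and dom: "\<And>j. AE x in lebesgue. u j x \<le> v x"
    and lim: "AE x in lebesgue. (\<lambda>j. u j x) \<longlonglongrightarrow> 0"
  shows "(\<lambda>j. rho (u j)) \<longlonglongrightarrow> 0"
  unfolding ennreal_tendsto_0_iff
proof (intro allI impI)
  fix e :: real assume "e > 0"
  obtain C where C: "C \<ge> 1" "\<And>u v. u \<in> borel_measurable lebesgue \<Longrightarrow> v \<in> borel_measurable lebesgue \<Longrightarrow>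
      rho (\<lambda>x. u x + v x) \<le> ennreal C * (rho u + rho v)"
    by (rule rho_triangle) blast
  obtain r where r: "rho v = ennreal r" "r \<ge> 0"
    using v by (cases "rho v") auto
  \<comment> \<open>Chosen so that \<open>d * rho v\<close> is below \<open>e / (2 * C)\<close>;
    using \<open>r + 1\<close> instead of \<open>r\<close> covers \<open>r = 0\<close>.\<close>
  define d where "d = e / (2 * C * (r + 1))"
  have "d > 0"
    using \<open>e > 0\<close> C(1) r(2) by (simp add: d_def)
  then have "d * r < d * (r + 1)" by simp
  also have "\<dots> = e / (2 * C)"
    using C(1) r(2) by (simp add: d_def)
  finally have "d * r < e / (2 * C)" .
  define E where "E j = {x. ennreal d * v x < u j x}" for j
  have [measurable]: "E j \<in> sets lebesgue" for j
  proof -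
    have "{x \<in> space lebesgue. ennreal d * v x < u j x} \<in> sets lebesgue" by measurable
    then show ?thesis by (simp add: E_def)
  qed
  have "absolutely_continuous_at N (\<lambda>x. ec_of_ennreal (v x))"
    using ac v unfolding absolutely_continuous_quasinorm_def
    by (auto simp: ae_class_in_qbfs_iff N_eq_rho)
  moreover have "AE x in lebesgue. \<forall>\<^sub>F j in sequentially. x \<notin> E j"
  proof -
    have "AE x in lebesgue. \<forall>j. u j x \<le> v x"
      using dom by (simp add: AE_all_countable)
    with lim show ?thesis
    proof eventually_elim
      case (elim x)
      \<comment> \<open>Where \<open>v\<close> vanishes, so does every \<open>u j\<close>, and the
        strict inequality in \<open>E\<close> excludes the point. Elsewhere \<open>d * v x\<close>
        is a positive threshold below which \<open>u j x\<close> eventually falls.\<close>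
      show ?case
      proof (cases "v x = 0")
        case True
        with elim(2) have "x \<notin> E j" for j
          by (simp add: E_def)
        then show ?thesis by simp
      next
        case False
        then have "0 < ennreal d * v x"
          using \<open>d > 0\<close> by (simp add: ennreal_zero_less_mult_iff zero_less_iff_neq_zero)
        from order_tendstoD(2)[OF elim(1) this] show ?thesis
          by eventually_elim (simp add: E_def)
      qed
    qed
  qed
  ultimately have "(\<lambda>j. rho (\<lambda>x. indicator (E j) x * v x)) \<longlonglongrightarrow> 0"
    by (subst (asm) absolutely_continuous_at_iff) auto
  then have "\<forall>\<^sub>F j in sequentially. rho (\<lambda>x. indicator (E j) x * v x) < ennreal (e / (2 * C))"
    using \<open>e > 0\<close> C(1) by (simp add: ennreal_tendsto_0_iff)
  then show "\<forall>\<^sub>F j in sequentially. rho (u j) < ennreal e"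
  proof eventually_elim
    case (elim j)
    have "rho (\<lambda>x. ennreal d * v x) < ennreal (e / (2 * C))"
      using \<open>d > 0\<close> \<open>d * r < e / (2 * C)\<close> r
      by (subst rho_cmult) (auto simp: ennreal_less_iff simp flip: ennreal_mult)
    with elim C(1) have
      "ennreal C * (rho (\<lambda>x. ennreal d * v x) + rho (\<lambda>x. indicator (E j) x * v x)) < ennreal e"
      by (intro ennreal_half_half_less)
    moreover have "rho (u j) \<le> rho (\<lambda>x. ennreal d * v x + indicator (E j) x * v x)"
    proof (rule rho_mono_AE)
      show "AE x in lebesgue. u j x \<le> ennreal d * v x + indicator (E j) x * v x"
        using dom[of j] by eventually_elim (auto simp: E_def add_increasing split: split_indicator)
    qed measurable
    ultimately show ?case
      using C(2)[of "\<lambda>x. ennreal d * v x" "\<lambda>x. indicator (E j) x * v x"] by fastforce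
  qed
qed

text \<open>Closeness to \<open>D\<close> in quasinorm, stated for complex-valued functions so that
  infinite values stay out of the approximation argument.\<close>

definition approximable :: "('a \<Rightarrow> complex) set \<Rightarrow> ('a \<Rightarrow> complex) \<Rightarrow> bool" where
  "approximable D f \<longleftrightarrow> (\<forall>e>0. \<exists>d\<in>D. rho (\<lambda>x. ennreal (cmod (d x - f x))) < ennreal e)"

text \<open>Lets successive approximations be composed: each passage to a limit costs one factor
  \<open>2 * C\<close>, absorbed by asking for a smaller tolerance beforehand.\<close>

lemma approximable_limit:
  assumes D: "\<And>d. d \<in> D \<Longrightarrow> d \<in> borel_measurable lebesgue"
    and g: "\<And>j::nat. g j \<in> borel_measurable lebesgue"
    and f: "f \<in> borel_measurable lebesgue"
    and appr: "\<And>j. approximable D (g j)"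
    and lim: "(\<lambda>j. rho (\<lambda>x. ennreal (cmod (g j x - f x)))) \<longlonglongrightarrow> 0"
  shows "approximable D f"
  unfolding approximable_def
proof (intro allI impI)
  fix e :: real assume "e > 0"
  obtain C where C: "C \<ge> 1" "\<And>u v. u \<in> borel_measurable lebesgue \<Longrightarrow> v \<in> borel_measurable lebesgue \<Longrightarrow>
      rho (\<lambda>x. u x + v x) \<le> ennreal C * (rho u + rho v)"
    by (rule rho_triangle) blast
  have e': "e / (2 * C) > 0" using \<open>e > 0\<close> C(1) by simp
  have "\<forall>\<^sub>F j in sequentially. rho (\<lambda>x. ennreal (cmod (g j x - f x))) < ennreal (e / (2 * C))"
    using lim e' by (simp add: ennreal_tendsto_0_iff)
  then obtain j where j: "rho (\<lambda>x. ennreal (cmod (g j x - f x))) < ennreal (e / (2 * C))"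
    by (auto dest: eventually_happens)
  obtain d where d: "d \<in> D" "rho (\<lambda>x. ennreal (cmod (d x - g j x))) < ennreal (e / (2 * C))"
    using appr[of j] e' by (auto simp: approximable_def)
  note [measurable] = g[of j] f D[OF d(1)]
  have "cmod (a - c) \<le> cmod (a - b) + cmod (b - c)" for a b c :: complex
    using norm_triangle_ineq[of "a - b" "b - c"] by simp
  then have "rho (\<lambda>x. ennreal (cmod (d x - f x))) \<le>
      rho (\<lambda>x. ennreal (cmod (d x - g j x)) + ennreal (cmod (g j x - f x)))"
    by (intro rho_mono_AE) (auto simp flip: ennreal_plus)
  also have "\<dots> \<le> ennreal C *
      (rho (\<lambda>x. ennreal (cmod (d x - g j x))) + rho (\<lambda>x. ennreal (cmod (g j x - f x))))"
    by (intro C(2)) measurable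
  also have "\<dots> < ennreal e"
    using C(1) d(2) j by (rule ennreal_half_half_less)
  finally show "\<exists>d\<in>D. rho (\<lambda>x. ennreal (cmod (d x - f x))) < ennreal e"
    using d(1) by blast
qed

end

section \<open>Absolute continuity implies separability\<close>

lemma emeasure_lebesgue_cball_finite: "emeasure lebesgue (cball c r :: 'a::euclidean_space set) < \<infinity>"
  using emeasure_bounded_finite[OF bounded_cball[of c r]] by simp

lemma cball_sets_lebesgue [measurable]: "cball (c::'a::euclidean_space) r \<in> sets lebesgue"
  by simp

context quasi_banach_function_norm
begin

lemma rho_cmod_diff_tendsto_0:
  fixes g :: "nat \<Rightarrow> 'a \<Rightarrow> complex"
  assumes ac: "absolutely_continuous_quasinorm N"
    and [measurable]: "\<And>j. g j \<in> borel_measurable lebesgue" "f \<in> borel_measurable lebesgue"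
    and bnd: "\<And>j x. cmod (g j x) \<le> K * indicator (cball 0 k) x"
    and lim: "AE x in lebesgue. (\<lambda>j. g j x) \<longlonglongrightarrow> f x"
  shows "(\<lambda>j. rho (\<lambda>x. ennreal (cmod (g j x - f x)))) \<longlonglongrightarrow> 0"
proof (rule rho_dominated_convergence[OF ac])
  \<comment> \<open>One bound for \<open>g j\<close> and one for its limit \<open>f\<close>, which
    inherits it almost everywhere; hence the factor 2. The absolute value is there because the sign
    of \<open>K\<close> is not prescribed.\<close>
  let ?v = "\<lambda>x. ennreal (2 * \<bar>K\<bar> * indicator (cball 0 k) x)"
  show "?v \<in> borel_measurable lebesgue" by measurable
  show "rho ?v < \<infinity>"
    by (rule rho_bounded_finite[of _ "cball 0 k" "2 * \<bar>K\<bar>"])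
      (use emeasure_lebesgue_cball_finite[of 0 k] in \<open>auto split: split_indicator\<close>)
  show "AE x in lebesgue. ennreal (cmod (g j x - f x)) \<le> ?v x" for j
    using lim
  proof eventually_elim
    case (elim x)
    have le: "cmod (g j x) \<le> \<bar>K\<bar> * indicator (cball 0 k) x" for j
      by (rule order_trans[OF bnd]) (auto split: split_indicator)
    have "cmod (f x) \<le> \<bar>K\<bar> * indicator (cball 0 k) x"
      by (rule Lim_norm_ubound[OF _ elim]) (simp_all add: le)
    with le[of j] show ?case
      using norm_triangle_ineq4[of "g j x" "f x"] by (intro ennreal_leI) simp
  qed
  show "AE x in lebesgue. (\<lambda>j. ennreal (cmod (g j x - f x))) \<longlonglongrightarrow> 0"
    using lim
  proof eventually_elim
    case (elim x)
    then have "(\<lambda>j. cmod (g j x - f x)) \<longlonglongrightarrow> 0"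
      by (rule tendsto_norm_zero[OF LIM_zero])
    then show ?case
      using tendsto_ennrealI by fastforce
  qed
qed measurable

text \<open>The continuous functions converging to \<open>h\<close> almost everywhere may be
  unbounded. Composing them with the nearest-point projection onto the disc of radius
  \<open>K\<close> bounds them and keeps them continuous, and it does not disturb the limit on the
  ball, since \<open>h\<close> takes its values in that disc.\<close>

lemma approximable_bounded:
  fixes h :: "'a \<Rightarrow> complex" and k :: nat
  assumes ac: "absolutely_continuous_quasinorm N"
    and D: "\<And>d. d \<in> D \<Longrightarrow> d \<in> borel_measurable lebesgue"
      "\<And>(g :: 'a \<Rightarrow> complex) (k :: nat) K. continuous_on UNIV g \<Longrightarrow> (\<And>x. cmod (g x) \<le> K) \<Longrightarrow>
      \<exists>s. (\<forall>m. s m \<in> D) \<and> (\<forall>m x. cmod (s m x) \<le> (K + 1) * indicator (cball 0 k) x) \<and>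
        (\<forall>x\<in>cball 0 k. (\<lambda>m. s m x) \<longlonglongrightarrow> g x)"
    and h: "h \<in> borel_measurable lebesgue"
    and "K \<ge> 0" and bnd: "\<And>x. cmod (h x) \<le> K * indicator (cball 0 k) x"
  shows "approximable D h"
proof -
  have "h measurable_on UNIV"
    using h by (intro lebesgue_measurable_imp_measurable_on) auto
  then obtain Z g0 where Z: "negligible Z" and g0: "\<And>n. continuous_on UNIV (g0 n)"
      "\<And>x. x \<notin> Z \<Longrightarrow> (\<lambda>n. g0 n x) \<longlonglongrightarrow> h x"
    by (auto simp: measurable_on_def)
  let ?p = "closest_point (cball (0::complex) K)"
  have cont_p: "continuous_on UNIV ?p"
    using \<open>K \<ge> 0\<close> by (intro continuous_on_closest_point) auto
  define g1 where "g1 n x = ?p (g0 n x)" for n x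
  have g1: "continuous_on UNIV (g1 n)" for n
    unfolding g1_def by (rule continuous_on_compose2[OF cont_p g0(1)]) simp
  have g1_le: "cmod (g1 n x) \<le> K" for n x
    using closest_point_in_set[of "cball 0 K" "g0 n x"] \<open>K \<ge> 0\<close> by (simp add: g1_def)
  define g where "g n x = indicator (cball 0 (real k)) x *\<^sub>R g1 n x" for n x
  have [measurable]: "g n \<in> borel_measurable lebesgue" for n
  proof -
    have [measurable]: "g1 n \<in> borel_measurable lebesgue"
      using borel_measurable_continuous_onI[OF g1] by (intro measurable_completion) simp
    show ?thesis
      unfolding g_def by measurable
  qed
  have g_le: "cmod (g n x) \<le> K * indicator (cball 0 (real k)) x" for n x
    using g1_le[of n x] by (auto simp: g_def split: split_indicator)
  show ?thesis
  proof (rule approximable_limit[where g = g])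
    show "(\<lambda>j. rho (\<lambda>x. ennreal (cmod (g j x - h x)))) \<longlonglongrightarrow> 0"
    proof (rule rho_cmod_diff_tendsto_0[OF ac _ h g_le])
      have "AE x in lebesgue. x \<notin> Z"
        using Z by (intro AE_not_in) (simp add: negligible_iff_null_sets)
      then show "AE x in lebesgue. (\<lambda>j. g j x) \<longlonglongrightarrow> h x"
      proof eventually_elim
        case (elim x)
        show ?case
        proof (cases "x \<in> cball 0 (real k)")
          case True
          then have "h x \<in> cball 0 K" using bnd[of x] by simp
          then have "?p (h x) = h x" by (rule closest_point_self)
          moreover have "(\<lambda>n. ?p (g0 n x)) \<longlonglongrightarrow> ?p (h x)"
            by (intro continuous_on_tendsto_compose[OF cont_p g0(2)[OF elim]]) auto
          ultimately show ?thesis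
            using True by (simp add: g_def g1_def)
        next
          case False
          then show ?thesis using bnd[of x] by (simp add: g_def)
        qed
      qed
    qed measurable
    show "approximable D (g n)" for n
    proof -
      obtain s where s: "\<And>m. s m \<in> D"
          "\<And>m x. cmod (s m x) \<le> (K + 1) * indicator (cball 0 (real k)) x"
          "\<And>x. x \<in> cball 0 (real k) \<Longrightarrow> (\<lambda>m. s m x) \<longlonglongrightarrow> g1 n x"
        using D(2)[OF g1[of n] g1_le, of k] by blast
      note [measurable] = D(1)[OF s(1)]
      \<comment> \<open>The cut-off function \<open>g n\<close> may be discontinuous, so the step
        functions are taken for \<open>g1 n\<close>. Outside the ball their bound forces them to
        vanish, as \<open>g n\<close> does.\<close>
      have "s m x = 0" if "x \<notin> cball 0 (real k)" for m x
        using s(2)[of m x] that by simp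
      then have "(\<lambda>m. s m x) \<longlonglongrightarrow> g n x" for x
        using s(3)[of x] by (cases "x \<in> cball 0 (real k)") (simp_all add: g_def)
      then have "(\<lambda>m. rho (\<lambda>x. ennreal (cmod (s m x - g n x)))) \<longlonglongrightarrow> 0"
        by (intro rho_cmod_diff_tendsto_0[OF ac _ _ s(2)]) auto
      then have "\<exists>d\<in>D. rho (\<lambda>x. ennreal (cmod (d x - g n x))) < ennreal e" if "e > 0" for e
        using that s(1) unfolding ennreal_tendsto_0_iff
        by (meson eventually_happens trivial_limit_sequentially)
      then show ?thesis
        by (simp add: approximable_def)
    qed
  qed (use D(1) h in auto)
qed

text \<open>Truncating \<open>h\<close> in value and support leaves at each point an error that is
  either 0 or \<open>- h x\<close>, so \<open>h\<close> dominates its own truncation errors; at each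
  point the error is eventually 0.\<close>

lemma approximable_finite_rho:
  fixes h :: "'a \<Rightarrow> complex"
  assumes ac: "absolutely_continuous_quasinorm N"
    and D: "\<And>d. d \<in> D \<Longrightarrow> d \<in> borel_measurable lebesgue"
      "\<And>(g :: 'a \<Rightarrow> complex) (k :: nat) K. continuous_on UNIV g \<Longrightarrow> (\<And>x. cmod (g x) \<le> K) \<Longrightarrow>
      \<exists>s. (\<forall>m. s m \<in> D) \<and> (\<forall>m x. cmod (s m x) \<le> (K + 1) * indicator (cball 0 k) x) \<and>
        (\<forall>x\<in>cball 0 k. (\<lambda>m. s m x) \<longlonglongrightarrow> g x)"
    and [measurable]: "h \<in> borel_measurable lebesgue"
    and fin: "rho (\<lambda>x. ennreal (cmod (h x))) < \<infinity>"
  shows "approximable D h"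
proof -
  define t where "t k x = (if cmod (h x) \<le> real k \<and> x \<in> cball 0 (real k) then h x else 0)"
    for k :: nat and x
  have [measurable]: "t k \<in> borel_measurable lebesgue" for k
    unfolding t_def by measurable
  show ?thesis
  proof (rule approximable_limit[where g = t])
    show "approximable D (t k)" for k
      by (rule approximable_bounded[OF ac D, where K = "real k" and k = k])
        (auto simp: t_def split: split_indicator)
    show "(\<lambda>k. rho (\<lambda>x. ennreal (cmod (t k x - h x)))) \<longlonglongrightarrow> 0"
    proof (rule rho_dominated_convergence[OF ac _ _ fin])
      show "AE x in lebesgue. ennreal (cmod (t k x - h x)) \<le> ennreal (cmod (h x))" for k
        by (simp add: t_def)
      have "(\<lambda>k. ennreal (cmod (t k x - h x))) \<longlonglongrightarrow> 0" for x
      proof (rule tendsto_eventually)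
        have "\<forall>\<^sub>F k in sequentially. max (cmod (h x)) (norm x) \<le> real k"
          using filterlim_real_sequentially unfolding filterlim_at_top by blast
        then show "\<forall>\<^sub>F k in sequentially. ennreal (cmod (t k x - h x)) = 0"
          by eventually_elim (simp add: t_def)
      qed
      then show "AE x in lebesgue. (\<lambda>k. ennreal (cmod (t k x - h x))) \<longlonglongrightarrow> 0"
        by simp
    qed measurable
  qed (use D(1) in auto)
qed

lemma absolutely_continuous_imp_separable:
  assumes ac: "absolutely_continuous_quasinorm N"
  shows "separable_space (qbfs_topology N)"
proof -
  obtain D :: "('a \<Rightarrow> complex) set" where D: "countable D"
    "\<And>d. d \<in> D \<Longrightarrow> d \<in> borel_measurable lebesgue"
    "\<And>d. d \<in> D \<Longrightarrow> \<exists>K\<ge>0. \<exists>k. \<forall>x. cmod (d x) \<le> K * indicator (cball 0 k) x"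
    "\<And>(g :: 'a \<Rightarrow> complex) (k :: nat) K. continuous_on UNIV g \<Longrightarrow> (\<And>x. cmod (g x) \<le> K) \<Longrightarrow>
      \<exists>s. (\<forall>m. s m \<in> D) \<and> (\<forall>m x. cmod (s m x) \<le> (K + 1) * indicator (cball 0 k) x) \<and>
        (\<forall>x\<in>cball 0 k. (\<lambda>m. s m x) \<longlonglongrightarrow> g x)"
    using countable_step_functions by blast
  let ?emb = "\<lambda>d :: 'a \<Rightarrow> complex. ae_class (\<lambda>x. Some (d x))"
  have emb: "?emb d \<in> qbfs N" if "d \<in> D" for d
  proof -
    note [measurable] = D(2)[OF that]
    obtain K k where "K \<ge> 0" and bnd: "\<And>x. cmod (d x) \<le> K * indicator (cball 0 k) x"
      using D(3)[OF \<open>d \<in> D\<close>] by blast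
    have "ennreal (cmod (d x)) \<le> ennreal K * indicator (cball 0 k) x" for x
      using bnd[of x] by (cases "x \<in> cball 0 k") (simp_all add: ennreal_leI del: mem_cball)
    then have "rho (\<lambda>x. ennreal (cmod (d x))) < \<infinity>"
      using \<open>K \<ge> 0\<close> by (intro rho_bounded_finite[OF _ _ emeasure_lebesgue_cball_finite]) auto
    then show ?thesis
      by (simp add: ae_class_in_qbfs_iff N_eq_rho)
  qed
  have "F \<in> qbfs_topology N closure_of (?emb ` D)" if F: "F \<in> qbfs N" for F
    unfolding in_closure_of
  proof (intro conjI allI impI)
    show "F \<in> topspace (qbfs_topology N)" using F by simp
    fix U assume U: "F \<in> U \<and> openin (qbfs_topology N) U"
    obtain f where f: "f \<in> lebesgue \<rightarrow>\<^sub>M ecborel" "F = ae_class f"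
      using F by (auto simp: qbfs_def elim: meas_funs_obtain)
    note [measurable] = f(1)
    obtain e where e: "e > 0" "\<And>g. ae_class g \<in> qbfs N \<Longrightarrow>
        N (ae_class (\<lambda>x. ecdiff (g x) (f x))) < ennreal e \<Longrightarrow> ae_class g \<in> U"
      using U f(2) unfolding openin_qbfs_topology qbfs_open_def by blast
    \<comment> \<open>Where \<open>f\<close> is infinite, \<open>ecdiff\<close> is infinite too,
      whereas \<open>ecfin\<close> gives 0; the two distances agree only because this happens on a
      null set.\<close>
    have fin: "AE x in lebesgue. f x \<noteq> None"
      using F f(2) by (intro AE_not_None) simp
    have "rho (\<lambda>x. ennreal (cmod (ecfin (f x)))) \<le> rho (\<lambda>x. ecabs (f x))"
      by (intro rho_mono_AE) (auto simp: ecabs_alt)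
    also have "\<dots> < \<infinity>"
      using F f by (simp add: ae_class_in_qbfs_iff N_eq_rho)
    finally have "approximable D (\<lambda>x. ecfin (f x))"
      by (intro approximable_finite_rho[OF ac D(2) D(4)]) auto
    then obtain d where d: "d \<in> D" "rho (\<lambda>x. ennreal (cmod (d x - ecfin (f x)))) < ennreal e"
      using \<open>e > 0\<close> by (auto simp: approximable_def)
    note [measurable] = D(2)[OF d(1)]
    have "N (ae_class (\<lambda>x. ecdiff (Some (d x)) (f x))) = rho (\<lambda>x. ecabs (ecdiff (Some (d x)) (f x)))"
      by (rule N_eq_rho) measurable
    also have "\<dots> = rho (\<lambda>x. ennreal (cmod (d x - ecfin (f x))))"
    proof (rule rho_cong_AE)
      show "AE x in lebesgue. ecabs (ecdiff (Some (d x)) (f x)) = ennreal (cmod (d x - ecfin (f x)))"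
        using fin by eventually_elim (simp add: ecdiff_alt del: not_None_eq)
    qed measurable
    finally have "?emb d \<in> U"
      using d emb by (intro e(2)) auto
    with d(1) show "\<exists>G. G \<in> ?emb ` D \<and> G \<in> U" by blast
  qed
  then have "qbfs_topology N closure_of (?emb ` D) = topspace (qbfs_topology N)"
    by (intro antisym closure_of_subset_topspace) auto
  then show ?thesis
    unfolding separable_space_def using D(1) emb by (intro exI[of _ "?emb ` D"]) auto
qed

end

section \<open>Separability implies absolute continuity\<close>

context quasi_banach_function_norm
begin

lemma P3_rho:
  fixes u :: "nat \<Rightarrow> 'a \<Rightarrow> ennreal"
  assumes "\<And>k. u k \<in> borel_measurable lebesgue" "v \<in> borel_measurable lebesgue"
    and "AE x in lebesgue. incseq (\<lambda>k. u k x) \<and> (\<lambda>k. u k x) \<longlonglongrightarrow> v x"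
  shows "(\<lambda>k. rho (u k)) \<longlonglongrightarrow> rho v"
  using P3[OF assms] by (simp add: rho_def)

text \<open>Pass to the tail unions \<open>F k\<close>. They decrease, almost every point eventually
  leaves them, and each keeps quasinorm at least \<open>e\<close>. The differences
  \<open>F k - F j\<close> increase with \<open>j\<close> to \<open>F k\<close> almost everywhere,
  so by P3 some difference already carries at least \<open>e / 2\<close>. Iterating from
  \<open>j\<close> produces the disjoint sets.\<close>

lemma disjoint_sets_of_not_absolutely_continuous:
  assumes f: "f \<in> lebesgue \<rightarrow>\<^sub>M ecborel" and nac: "\<not> absolutely_continuous_at N f"
  obtains e :: real and G :: "nat \<Rightarrow> 'a set"
  where "e > 0" "\<And>i. G i \<in> sets lebesgue" "disjoint_family G"
    "\<And>i. ennreal e \<le> rho (\<lambda>x. indicator (G i) x * ecabs (f x))"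
proof -
  note [measurable] = f
  let ?r = "\<lambda>A. rho (\<lambda>x. indicator A x * ecabs (f x))"
  have r_mono: "?r A \<le> ?r B" if [measurable]: "A \<in> sets lebesgue" "B \<in> sets lebesgue" and "A \<subseteq> B" for A B
    using \<open>A \<subseteq> B\<close> by (intro rho_mono_AE) (auto split: split_indicator)
  obtain E e where E [measurable]: "\<And>k::nat. E k \<in> sets lebesgue"
      and E0: "AE x in lebesgue. \<forall>\<^sub>F k in sequentially. x \<notin> E k"
      and e: "e > 0" "\<not> (\<forall>\<^sub>F k in sequentially. ?r (E k) < ennreal e)"
    using nac unfolding absolutely_continuous_at_iff[OF f] ennreal_tendsto_0_iff by blast
  define F where "F k = (\<Union>j\<in>{k..}. E j)" for k
  have F [measurable]: "F k \<in> sets lebesgue" for k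
    unfolding F_def by measurable
  have F_anti: "F j \<subseteq> F k" if "k \<le> j" for j k
    using that by (force simp: F_def)
  have F_ge: "ennreal e \<le> ?r (F k)" for k
  proof -
    obtain j where j: "j \<ge> k" "ennreal e \<le> ?r (E j)"
      using e(2) unfolding eventually_sequentially by (metis not_le)
    note j(2)
    also have "?r (E j) \<le> ?r (F k)"
      using j(1) by (intro r_mono) (auto simp: F_def)
    finally show ?thesis .
  qed
  have "\<exists>j>k. ennreal (e / 2) \<le> ?r (F k - F j)" for k
  proof -
    have "(\<lambda>j. ?r (F k - F j)) \<longlonglongrightarrow> ?r (F k)"
    proof (rule P3_rho)
      show "AE x in lebesgue. incseq (\<lambda>j. indicator (F k - F j) x * ecabs (f x)) \<and>
          (\<lambda>j. indicator (F k - F j) x * ecabs (f x)) \<longlonglongrightarrow> indicator (F k) x * ecabs (f x)"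
        using E0
      proof eventually_elim
        case (elim x)
        then obtain m where "\<And>j. j \<ge> m \<Longrightarrow> x \<notin> E j"
          by (auto simp: eventually_sequentially)
        then have "x \<notin> F j" if "j \<ge> m" for j
          using that by (auto simp: F_def)
        then have "\<forall>\<^sub>F j in sequentially.
            indicator (F k - F j) x * ecabs (f x) = indicator (F k) x * ecabs (f x)"
          unfolding eventually_sequentially by (intro exI[of _ m]) (auto split: split_indicator)
        moreover have "incseq (\<lambda>j. indicator (F k - F j) x * ecabs (f x))"
          using F_anti by (intro monoI mult_right_mono) (auto split: split_indicator)
        ultimately show ?case
          by (auto intro: tendsto_eventually)
      qed
    qed measurable
    \<comment> \<open>The limit may equal \<open>e\<close> exactly, so terms of the sequence can
      only be guaranteed to exceed a smaller number.\<close>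
    moreover have "ennreal (e / 2) < ?r (F k)"
      by (rule less_le_trans[OF _ F_ge]) (use e(1) in \<open>simp add: ennreal_less_iff\<close>)
    ultimately have "\<forall>\<^sub>F j in sequentially. ennreal (e / 2) < ?r (F k - F j)"
      by (rule order_tendstoD(1))
    then have "\<forall>\<^sub>F j in sequentially. ennreal (e / 2) < ?r (F k - F j) \<and> j > k"
      using eventually_gt_at_top by (rule eventually_conj)
    then show ?thesis
      by (auto dest!: eventually_happens intro: less_imp_le)
  qed
  then obtain next_idx where next_idx: "\<And>k. next_idx k > k"
      "\<And>k. ennreal (e / 2) \<le> ?r (F k - F (next_idx k))"
    by metis
  define s where "s i = (next_idx ^^ i) 0" for i
  have "strict_mono s"
    unfolding strict_mono_Suc_iff by (simp add: s_def next_idx)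
  define G where "G i = F (s i) - F (s (Suc i))" for i
  have "G i \<inter> G j = {}" if "i < j" for i j
  proof -
    have "s (Suc i) \<le> s j"
      using that \<open>strict_mono s\<close> by (simp add: strict_mono_less_eq)
    then show ?thesis
      using F_anti by (auto simp: G_def)
  qed
  then have "disjoint_family G"
    unfolding disjoint_family_on_def by (metis Int_commute linorder_neqE_nat)
  moreover have "G i \<in> sets lebesgue" for i
    unfolding G_def by measurable
  moreover have "ennreal (e / 2) \<le> ?r (G i)" for i
    using next_idx(2)[of "s i"] by (simp add: G_def s_def)
  ultimately show ?thesis
    using e(1) by (intro that[of "e / 2" G]) auto
qed

text \<open>Differences are formed from representatives while members of the ball are classes, hence
  the existential quantifier. The next two lemmas show that neither the choice of \<open>g\<close>
  nor that of \<open>f\<close> matters.\<close>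

definition qball :: "('a \<Rightarrow> ecomplex) \<Rightarrow> real \<Rightarrow> ('a \<Rightarrow> ecomplex) set set" where
  "qball f r = {F. \<exists>g. F = ae_class g \<and> ae_class g \<in> qbfs N \<and>
     rho (\<lambda>x. ecabs (ecdiff (g x) (f x))) < ennreal r}"

lemma ae_class_in_qball_iff:
  assumes [measurable]: "f \<in> lebesgue \<rightarrow>\<^sub>M ecborel"
  shows "ae_class g \<in> qball f r \<longleftrightarrow>
    ae_class g \<in> qbfs N \<and> rho (\<lambda>x. ecabs (ecdiff (g x) (f x))) < ennreal r"
proof -
  have "rho (\<lambda>x. ecabs (ecdiff (g x) (f x))) = rho (\<lambda>x. ecabs (ecdiff (h x) (f x)))"
    if "ae_class g = ae_class h" "ae_class h \<in> qbfs N" for h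
  proof -
    have [measurable]: "g \<in> lebesgue \<rightarrow>\<^sub>M ecborel" "h \<in> lebesgue \<rightarrow>\<^sub>M ecborel"
      using that by (auto simp: ae_class_in_qbfs_iff qbfs_def simp flip: ae_class_in_meas_funs_iff)
    have "AE x in lebesgue. g x = h x"
      by (rule ae_class_eqD) (use that in auto)
    then show ?thesis
      by (intro rho_cong_AE) (auto elim: eventually_mono)
  qed
  then show ?thesis
    by (auto simp: qball_def)
qed

lemma qball_cong:
  assumes "ae_class f = ae_class f'" and [measurable]: "f \<in> lebesgue \<rightarrow>\<^sub>M ecborel" "f' \<in> lebesgue \<rightarrow>\<^sub>M ecborel"
  shows "qball f r = qball f' r"
proof -
  have "AE x in lebesgue. f x = f' x"
    by (rule ae_class_eqD) (use assms in auto)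
  then have "rho (\<lambda>x. ecabs (ecdiff (g x) (f x))) = rho (\<lambda>x. ecabs (ecdiff (g x) (f' x)))"
    if [measurable]: "g \<in> lebesgue \<rightarrow>\<^sub>M ecborel" for g
    by (intro rho_cong_AE) (auto elim: eventually_mono)
  then show ?thesis
    by (auto simp: qball_def ae_class_in_qbfs_iff)
qed

lemma ae_class_in_qball_self:
  assumes "ae_class f \<in> qbfs N" "r > 0"
  shows "ae_class f \<in> qball f r"
proof -
  have [measurable]: "f \<in> lebesgue \<rightarrow>\<^sub>M ecborel"
    using assms by (simp add: ae_class_in_qbfs_iff)
  have "AE x in lebesgue. ecabs (ecdiff (f x) (f x)) = 0"
    using AE_not_None[OF assms(1)] by eventually_elim (simp add: ecdiff_alt del: not_None_eq)
  then have "rho (\<lambda>x. ecabs (ecdiff (f x) (f x))) = 0"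
    using Q1b[of "\<lambda>x. ecabs (ecdiff (f x) (f x))"] by (simp add: rho_def)
  then show ?thesis
    using assms by (simp add: ae_class_in_qball_iff)
qed

lemma rho_ecdiff_triangle:
  obtains C :: real where "C \<ge> 1"
    "\<And>f g h e. f \<in> lebesgue \<rightarrow>\<^sub>M ecborel \<Longrightarrow> g \<in> lebesgue \<rightarrow>\<^sub>M ecborel \<Longrightarrow> h \<in> lebesgue \<rightarrow>\<^sub>M ecborel \<Longrightarrow>
      rho (\<lambda>x. ecabs (ecdiff (f x) (g x))) < ennreal (e / (2 * C)) \<Longrightarrow>
      rho (\<lambda>x. ecabs (ecdiff (g x) (h x))) < ennreal (e / (2 * C)) \<Longrightarrow>
      rho (\<lambda>x. ecabs (ecdiff (f x) (h x))) < ennreal e"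
proof -
  obtain C where C: "C \<ge> 1" "\<And>u v. u \<in> borel_measurable lebesgue \<Longrightarrow> v \<in> borel_measurable lebesgue \<Longrightarrow>
      rho (\<lambda>x. u x + v x) \<le> ennreal C * (rho u + rho v)"
    by (rule rho_triangle) blast
  show ?thesis
  proof (rule that[OF C(1)])
    fix f g h :: "'a \<Rightarrow> ecomplex" and e
    let ?d = "\<lambda>f g. rho (\<lambda>x. ecabs (ecdiff (f x) (g x)))"
    assume [measurable]: "f \<in> lebesgue \<rightarrow>\<^sub>M ecborel" "g \<in> lebesgue \<rightarrow>\<^sub>M ecborel" "h \<in> lebesgue \<rightarrow>\<^sub>M ecborel"
      and less: "?d f g < ennreal (e / (2 * C))" "?d g h < ennreal (e / (2 * C))"
    have "?d f h \<le> rho (\<lambda>x. ecabs (ecdiff (f x) (g x)) + ecabs (ecdiff (g x) (h x)))"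
      by (intro rho_mono_AE) (auto simp: ecabs_ecdiff_triangle)
    also have "\<dots> \<le> ennreal C * (?d f g + ?d g h)"
      by (rule C(2)) measurable
    also have "\<dots> < ennreal e"
      using C(1) less by (rule ennreal_half_half_less)
    finally show "?d f h < ennreal e" .
  qed
qed

text \<open>Quasinorm balls need not be open, but the points around which some ball stays inside a
  given ball form an open set.\<close>

lemma open_nbhd_in_qball:
  assumes f: "ae_class f \<in> qbfs N" and "r > 0"
  obtains U where "qbfs_open N U" "ae_class f \<in> U" "U \<subseteq> qball f r"
proof
  have f_meas [measurable]: "f \<in> lebesgue \<rightarrow>\<^sub>M ecborel"
    using f by (simp add: ae_class_in_qbfs_iff)
  obtain C where C: "C \<ge> 1"
    "\<And>f g h e. f \<in> lebesgue \<rightarrow>\<^sub>M ecborel \<Longrightarrow> g \<in> lebesgue \<rightarrow>\<^sub>M ecborel \<Longrightarrow> h \<in> lebesgue \<rightarrow>\<^sub>M ecborel \<Longrightarrow>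
      rho (\<lambda>x. ecabs (ecdiff (f x) (g x))) < ennreal (e / (2 * C)) \<Longrightarrow>
      rho (\<lambda>x. ecabs (ecdiff (g x) (h x))) < ennreal (e / (2 * C)) \<Longrightarrow>
      rho (\<lambda>x. ecabs (ecdiff (f x) (h x))) < ennreal e"
    by (rule rho_ecdiff_triangle) blast
  \<comment> \<open>This plays the role of the interior of the ball; that it is open is where the
    quasi-triangle inequality enters.\<close>
  let ?U = "{F. \<exists>g t. F = ae_class g \<and> ae_class g \<in> qbfs N \<and> t > 0 \<and> qball g t \<subseteq> qball f r}"
  show "ae_class f \<in> ?U" using f \<open>r > 0\<close> by blast
  show "?U \<subseteq> qball f r" using ae_class_in_qball_self by blast
  show "qbfs_open N ?U"
    unfolding qbfs_open_def
  proof (intro conjI allI impI)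
    show "?U \<subseteq> qbfs N" by auto
    fix g assume "ae_class g \<in> ?U"
    then obtain g' t where g': "ae_class g = ae_class g'" "ae_class g' \<in> qbfs N" "t > 0"
        "qball g' t \<subseteq> qball f r"
      by blast
    then have g [measurable]: "g \<in> lebesgue \<rightarrow>\<^sub>M ecborel" and "g' \<in> lebesgue \<rightarrow>\<^sub>M ecborel"
      by (metis ae_class_in_qbfs_iff)+
    with g' have sub: "qball g t \<subseteq> qball f r"
      using qball_cong by metis
    show "\<exists>e::real. e > 0 \<and> (\<forall>h. ae_class h \<in> qbfs N \<and>
        N (ae_class (\<lambda>x. ecdiff (h x) (g x))) < ennreal e \<longrightarrow> ae_class h \<in> ?U)"
    \<comment> \<open>If \<open>h\<close> is within \<open>t / (2 * C)\<close> of \<open>g\<close>,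
      the ball of that same radius around \<open>h\<close> lies inside the ball of radius
      \<open>t\<close> around \<open>g\<close>, so \<open>h\<close> again belongs to the
      set.\<close>
    proof (intro exI[of _ "t / (2 * C)"] conjI allI impI)
      show "t / (2 * C) > 0" using g'(3) C(1) by simp
      fix h assume h: "ae_class h \<in> qbfs N \<and> N (ae_class (\<lambda>x. ecdiff (h x) (g x))) < ennreal (t / (2 * C))"
      then have hm [measurable]: "h \<in> lebesgue \<rightarrow>\<^sub>M ecborel"
        by (simp add: ae_class_in_qbfs_iff)
      have hg: "rho (\<lambda>x. ecabs (ecdiff (h x) (g x))) < ennreal (t / (2 * C))"
        using h by (simp add: N_eq_rho)
      have "qball h (t / (2 * C)) \<subseteq> qball g t"
        using C(2)[OF _ hm g _ hg] by (auto simp: qball_def ae_class_in_qbfs_iff)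
      with sub h \<open>t / (2 * C) > 0\<close> show "ae_class h \<in> ?U" by blast
    qed
  qed
qed

lemma separable_imp_absolutely_continuous:
  assumes sep: "separable_space (qbfs_topology N)"
  shows "absolutely_continuous_quasinorm N"
  unfolding absolutely_continuous_quasinorm_def
proof (intro allI impI, rule ccontr)
  fix f assume f: "ae_class f \<in> qbfs N" and nac: "\<not> absolutely_continuous_at N f"
  have f_meas [measurable]: "f \<in> lebesgue \<rightarrow>\<^sub>M ecborel"
    using f by (simp add: ae_class_in_qbfs_iff)
  obtain G :: "nat \<Rightarrow> 'a set" and e :: real
    where "e > 0" and G [measurable]: "\<And>i. G i \<in> sets lebesgue" and disj: "disjoint_family G"
      and G_ge: "\<And>i. ennreal e \<le> rho (\<lambda>x. indicator (G i) x * ecabs (f x))"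
    by (rule disjoint_sets_of_not_absolutely_continuous[OF f_meas nac]) blast
  obtain C where C: "C \<ge> 1"
    "\<And>f g h e. f \<in> lebesgue \<rightarrow>\<^sub>M ecborel \<Longrightarrow> g \<in> lebesgue \<rightarrow>\<^sub>M ecborel \<Longrightarrow> h \<in> lebesgue \<rightarrow>\<^sub>M ecborel \<Longrightarrow>
      rho (\<lambda>x. ecabs (ecdiff (f x) (g x))) < ennreal (e / (2 * C)) \<Longrightarrow>
      rho (\<lambda>x. ecabs (ecdiff (g x) (h x))) < ennreal (e / (2 * C)) \<Longrightarrow>
      rho (\<lambda>x. ecabs (ecdiff (f x) (h x))) < ennreal e"
    by (rule rho_ecdiff_triangle) blast
  obtain D where D: "countable D" "D \<subseteq> qbfs N" "qbfs_topology N closure_of D = qbfs N"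
    using sep by (auto simp: separable_space_def)
  \<comment> \<open>Two functions within \<open>r\<close> of a common point are less than
    \<open>e\<close> apart, so one point of \<open>D\<close> cannot serve two members of an
    \<open>e\<close>-separated family.\<close>
  define r where "r = e / (2 * C)"
  have "r > 0" using \<open>e > 0\<close> C(1) by (simp add: r_def)
  define h where "h S x = ecscale (indicator (\<Union>i\<in>S. G i) x) (f x)" for S :: "nat set" and x
  have h_meas [measurable]: "h S \<in> lebesgue \<rightarrow>\<^sub>M ecborel" for S
  proof -
    have [measurable]: "(\<Union>i\<in>S. G i) \<in> sets lebesgue"
      by (intro sets.countable_UN') auto
    show ?thesis unfolding h_def by measurable
  qed
  have h: "ae_class (h S) \<in> qbfs N" for S
  proof -
    have "rho (\<lambda>x. ecabs (h S x)) \<le> rho (\<lambda>x. ecabs (f x))"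
      by (intro rho_mono_AE) (auto simp: h_def ecabs_ecscale split: split_indicator)
    with f show ?thesis
      by (auto simp: ae_class_in_qbfs_iff N_eq_rho intro: le_less_trans)
  qed
  have h_far: "ennreal e \<le> rho (\<lambda>x. ecabs (ecdiff (h S x) (h T x)))" if "i \<in> S" "i \<notin> T" for S T i
  proof -
    \<comment> \<open>On \<open>G i\<close>, disjointness gives \<open>h S x = f x\<close> and
      \<open>h T x = 0\<close>, so the difference there is \<open>f\<close> itself.\<close>
    have "indicator (G i) x * ecabs (f x) \<le> ecabs (ecdiff (h S x) (h T x))" for x
    proof (cases "x \<in> G i")
      case True
      have "x \<notin> (\<Union>i\<in>T. G i)"
        using True disj \<open>i \<notin> T\<close> by (auto simp: disjoint_family_on_def) (metis IntI UNIV_I empty_iff)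
      moreover have "x \<in> (\<Union>i\<in>S. G i)" using True \<open>i \<in> S\<close> by blast
      ultimately have "h S x = f x" "h T x = Some 0"
        by (auto simp: h_def ecscale_def split: option.splits)
      then show ?thesis
        using True by (cases "f x") (auto simp: ecdiff_def ecabs_def)
    qed simp
    then have "rho (\<lambda>x. indicator (G i) x * ecabs (f x)) \<le> rho (\<lambda>x. ecabs (ecdiff (h S x) (h T x)))"
      by (intro rho_mono_AE) auto
    with G_ge show ?thesis by (rule order_trans)
  qed
  have "\<exists>d. d \<in> D \<and> d \<in> qball (h S) r" for S
  proof -
    obtain U where U: "qbfs_open N U" "ae_class (h S) \<in> U" "U \<subseteq> qball (h S) r"
      using open_nbhd_in_qball[OF h \<open>r > 0\<close>] by blast
    have "ae_class (h S) \<in> qbfs_topology N closure_of D"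
      using h by (simp add: D(3))
    with U show ?thesis
      unfolding in_closure_of openin_qbfs_topology by blast
  qed
  then obtain d where d: "\<And>S. d S \<in> D" "\<And>S. d S \<in> qball (h S) r"
    by metis
  have "d S \<noteq> d T" if "i \<in> S" "i \<notin> T" for S T i
  proof
    assume "d S = d T"
    obtain g where g: "d S = ae_class g" "g \<in> lebesgue \<rightarrow>\<^sub>M ecborel"
      using d(2)[of S] by (auto simp: qball_def ae_class_in_qbfs_iff)
    then have "rho (\<lambda>x. ecabs (ecdiff (g x) (h S x))) < ennreal r"
        "rho (\<lambda>x. ecabs (ecdiff (g x) (h T x))) < ennreal r"
      using d(2)[of S] d(2)[of T] \<open>d S = d T\<close> by (auto simp: ae_class_in_qball_iff)
    then have "rho (\<lambda>x. ecabs (ecdiff (h S x) (h T x))) < ennreal e"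
      unfolding r_def by (intro C(2)[OF h_meas g(2) h_meas]) (simp_all add: ecabs_ecdiff_commute)
    with h_far[OF that] show False by simp
  qed
  \<comment> \<open>Distinct \<open>S\<close> and \<open>T\<close> are separated by an index in one
    but not the other; the previous fact applies in either order.\<close>
  then have "inj d"
    by (intro injI) blast
  moreover have "countable (range d)"
    using D(1) d(1) by (auto intro: countable_subset)
  ultimately have "countable (UNIV :: nat set set)"
    using countable_image_inj_on by blast
  then have "range (from_nat_into (UNIV :: nat set set)) = Pow UNIV"
    by simp
  then show False
    using Cantors_theorem by blast
qed

end

theorem theorem3p17:
  fixes N :: "(real ^ 'n \<Rightarrow> ecomplex) set \<Rightarrow> ennreal"
  assumes "quasi_banach_function_norm N"
  shows "separable_space (qbfs_topology N) \<longleftrightarrow> absolutely_continuous_quasinorm N"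
  using quasi_banach_function_norm.separable_imp_absolutely_continuous[OF assms]
    quasi_banach_function_norm.absolutely_continuous_imp_separable[OF assms] by blast

end
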